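(* Let $K$ be a field of characteristic zero and let $F\in K[x]^n$, $x=(x_1,\dots,x_n)$, be a Keller map. Suppose that for each $i$, $F_i=L_iH_i$ with $L_i,H_i\in K[x]$ and $\deg L_i=1$. Write $L=(L_1,\dots,L_n)$ and $L(0)=(L_1(0),\dots,L_n(0))\in K^n$. Then the following are equivalent: 1) for each $i$, the linear part (homogeneous part of degree $1$) of $L_i(0)H_i$ is divisible by $L_i-L_i(0)$; 2) $L(0)$ lies in the column space of the (constant) matrix $\mathcal{J}L$; 3) $\det\mathcal{J}L\in K^{*}$; 4) $\deg F=1$; 5) $F_i$ is irreducible for each $i$.
   Context: $\mathcal{J}$ denotes the Jacobian matrix with respect to $x$. A Keller map is a polynomial map $F\in K[x]^n$ with $\det\mathcal{J}F\in K^{*}$. *)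

theory Defs
  imports "HOL-Analysis.Analysis" "HOL-Library.Poly_Mapping"
    "HOL-Computational_Algebra.Factorial_Ring"
begin

text \<open>Multivariate polynomials over K in the variables x_i, i :: 'n (a finite type,
  so n = CARD('n)): finitely supported maps from monomials (exponent vectors
  'n =>0 nat) to coefficients.\<close>
type_synonym ('n, 'a) mpoly = "('n \<Rightarrow>\<^sub>0 nat) \<Rightarrow>\<^sub>0 'a"

definition mdeg :: "('n::finite \<Rightarrow>\<^sub>0 nat) \<Rightarrow> nat" where
  "mdeg m = (\<Sum>i\<in>UNIV. Poly_Mapping.lookup m i)"

definition mconst :: "'a::zero \<Rightarrow> ('n, 'a) mpoly" where
  "mconst c = Poly_Mapping.single 0 c"

definition at0 :: "('n, 'a::zero) mpoly \<Rightarrow> 'a" where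
  "at0 p = Poly_Mapping.lookup p 0"

definition tdeg :: "('n::finite, 'a::zero) mpoly \<Rightarrow> nat" where
  "tdeg p = (if p = 0 then 0 else Max (mdeg ` Poly_Mapping.keys p))"

definition hom_part :: "nat \<Rightarrow> ('n::finite, 'a::comm_monoid_add) mpoly \<Rightarrow> ('n, 'a) mpoly" where
  "hom_part d p = (\<Sum>m\<in>{m\<in>Poly_Mapping.keys p. mdeg m = d}. Poly_Mapping.single m (Poly_Mapping.lookup p m))"

definition pdiff :: "'n \<Rightarrow> ('n, 'a::comm_ring_1) mpoly \<Rightarrow> ('n, 'a) mpoly" where
  "pdiff i p = (\<Sum>m\<in>Poly_Mapping.keys p.
      Poly_Mapping.single (m - Poly_Mapping.single i 1) (of_nat (Poly_Mapping.lookup m i) * Poly_Mapping.lookup p m))"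

definition jacobian :: "('n::finite \<Rightarrow> ('n, 'a::comm_ring_1) mpoly) \<Rightarrow> ('n, 'a) mpoly ^'n^'n" where
  "jacobian F = (\<chi> i j. pdiff j (F i))"

definition keller :: "('n::finite \<Rightarrow> ('n, 'a::field) mpoly) \<Rightarrow> bool" where
  "keller F \<longleftrightarrow> (\<exists>c. c \<noteq> 0 \<and> det (jacobian F) = mconst c)"

definition map_deg :: "('n::finite \<Rightarrow> ('n, 'a::zero) mpoly) \<Rightarrow> nat" where
  "map_deg F = Max (range (\<lambda>i. tdeg (F i)))"

text \<open>For a map L of degree-one components, the constant matrix JL over K
  (entries are the constant terms of the partial derivatives).\<close>
definition const_jacobian :: "('n::finite \<Rightarrow> ('n, 'a::comm_ring_1) mpoly) \<Rightarrow> 'a^'n^'n" where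
  "const_jacobian L = (\<chi> i j. at0 (pdiff j (L i)))"

end

(*
The implications towards 3) compare determinants: as soon as the rows of JF at some point are
multiples of the rows of JL, det JL divides det JF. For 1) that point is 0, for 2) it is the common
zero of the L_i, and 4) holds iff all H_i are constant.

For 3) ==> 4), an affine change of coordinates gives F_i = x_i H_i, and then H_i(0) is nonzero.
If some H_i is not constant, take an extreme ray of the cone spanned by the exponents of all H_i,
and a weight w under which every H_i has a unique leading exponent a_i, lying on this ray.
The leading coefficient of det JF is then a nonzero multiple of det (delta_ij + a_ij), the
determinant of the identity plus a nonnegative matrix of rank one; it is nonzero and sits in weight
w(a_1) + ... + w(a_n) > 0, so det JF is not constant.
*)
theory Submission
  imports Defs
begin

section \<open>Partial derivatives and substitution\<close>

text \<open>Zero is a \<open>single\<close> with coefficient 0, so two cases suffice. Bilinear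
  identities thereby reduce to pairs of monomials.\<close>

lemma poly_mapping_add_induct [case_names single add]:
  assumes "\<And>k c. P (Poly_Mapping.single k c)"
    and "\<And>p q. P p \<Longrightarrow> P q \<Longrightarrow> P (p + q)"
  shows "P (p :: 'k \<Rightarrow>\<^sub>0 'c::comm_monoid_add)"
proof (induction p rule: update_induct)
  case const
  have "P (Poly_Mapping.single undefined 0)" by (rule assms(1))
  then show ?case by simp
next
  case (update f a b)
  then have "Poly_Mapping.update a b f = f + Poly_Mapping.single a b"
    by (intro poly_mapping_eqI)
      (auto simp: lookup_update lookup_add lookup_single when_def in_keys_iff)
  with update assms show ?case by simp
qed

text \<open>Translation by \<open>k\<close> is injective on exponents because the exponent monoid is
  cancellative, so exactly one term of \<open>q\<close> contributes.\<close>

lemma lookup_single_add_mult: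
  fixes q :: "('k::cancel_comm_monoid_add) \<Rightarrow>\<^sub>0 ('c::comm_semiring_0)"
  shows "Poly_Mapping.lookup (Poly_Mapping.single k c * q) (k + m) = c * Poly_Mapping.lookup q m"
proof (induction q rule: poly_mapping_add_induct)
  case (single k' c')
  then show ?case by (simp add: mult_single lookup_single when_def)
qed (simp add: algebra_simps lookup_add)

section \<open>Constants, and evaluation at the origin as a ring homomorphism\<close>

lemma mconst_simps [simp]:
  "mconst 0 = 0" "mconst 1 = 1"
  by (simp_all add: mconst_def)

lemma mconst_add: "mconst (a + b) = mconst a + mconst b"
  by (simp add: mconst_def single_add)

lemma mconst_mult: "mconst (a * b) = mconst a * mconst b"
  for a b :: "'a::semiring_0"
  by (simp add: mconst_def mult_single)

lemma mconst_sum: "mconst (sum f A) = (\<Sum>x\<in>A. mconst (f x))"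
  by (induction A rule: infinite_finite_induct) (simp_all add: mconst_add)

lemma mconst_eq_iff [simp]: "mconst a = mconst b \<longleftrightarrow> a = b"
  by (metis mconst_def lookup_single_eq)

lemma at0_mconst [simp]: "at0 (mconst c) = c"
  by (simp add: at0_def mconst_def)

lemma at0_simps [simp]: "at0 0 = 0" "at0 1 = 1"
  by (simp_all add: at0_def lookup_one)

lemma at0_add: "at0 (p + q) = at0 p + at0 q"
  by (simp add: at0_def lookup_add)

lemma at0_diff: "at0 (p - q) = at0 p - at0 q"
  for p :: "('n, 'a::ab_group_add) mpoly"
  by (simp add: at0_def lookup_minus)

lemma at0_sum: "at0 (sum f A) = (\<Sum>x\<in>A. at0 (f x))"
  by (simp add: at0_def lookup_sum)

lemma exponent_add_eq_0_iff [simp]: "m + m' = 0 \<longleftrightarrow> m = 0 \<and> m' = 0"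
  for m m' :: "'n \<Rightarrow>\<^sub>0 nat"
  by (auto simp: poly_mapping_eq_iff lookup_add fun_eq_iff)

lemma at0_mult: "at0 (p * q) = at0 p * at0 q"
  for p q :: "('n, 'a::comm_semiring_0) mpoly"
proof (induction p rule: poly_mapping_add_induct)
  case (single k c)
  show ?case
  proof (induction q rule: poly_mapping_add_induct)
    case (single k' c')
    then show ?case by (auto simp: mult_single at0_def lookup_single when_def)
  qed (simp add: algebra_simps at0_add)
qed (simp add: algebra_simps at0_add)

lemma single_exponent_neq_0 [simp]: "Poly_Mapping.single i (Suc n) \<noteq> 0"
  by (metis lookup_single_eq lookup_zero nat.distinct(1))

definition mvar :: "'n \<Rightarrow> ('n, 'a::zero_neq_one) mpoly" where
  "mvar i = Poly_Mapping.single (Poly_Mapping.single i 1) 1"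

lemma at0_mvar [simp]: "at0 (mvar i) = 0"
  by (simp add: at0_def mvar_def lookup_single when_def)

text \<open>Constants and variables generate the polynomial algebra. Substitutions and derivations
  can therefore be compared on these generators.\<close>

lemma mpoly_induct [case_names mconst mvar add mult]:
  fixes p :: "('n, 'a::comm_semiring_1) mpoly"
  assumes const: "\<And>c. P (mconst c)" and var: "\<And>i. P (mvar i)"
    and add: "\<And>p q. P p \<Longrightarrow> P q \<Longrightarrow> P (p + q)"
    and mult: "\<And>p q. P p \<Longrightarrow> P q \<Longrightarrow> P (p * q)"
  shows "P p"
proof (induction p rule: poly_mapping_add_induct)
  case (single k c)
  have "P (Poly_Mapping.single k 1)"
  \<comment> \<open>Exponent vectors are finitely supported maps as well, so the same additive
    induction applies to them; sums of exponents become products of monomials.\<close>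
  proof (induction k rule: poly_mapping_add_induct)
    case (single i n)
    show ?case
    proof (induction n)
      case 0
      then show ?case using const[of 1] by (simp add: mconst_def)
    next
      case (Suc n)
      have "Poly_Mapping.single (Poly_Mapping.single i (Suc n)) (1 :: 'a)
          = mvar i * Poly_Mapping.single (Poly_Mapping.single i n) 1"
        by (simp add: mvar_def mult_single flip: single_add)
      with Suc mult var show ?case by simp
    qed
  next
    case (add m m')
    have "Poly_Mapping.single (m + m') (1 :: 'a) = Poly_Mapping.single m 1 * Poly_Mapping.single m' 1"
      by (simp add: mult_single)
    with add mult show ?case by simp
  qed
  with const mult have "P (mconst c * Poly_Mapping.single k 1)" by blast
  then show ?case by (simp add: mconst_def mult_single)
qed (rule add)

section \<open>Coefficients and rules of formal partial derivatives\<close>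

lemma lookup_pdiff:
  "Poly_Mapping.lookup (pdiff i p) m =
     of_nat (Suc (Poly_Mapping.lookup m i)) * Poly_Mapping.lookup p (m + Poly_Mapping.single i 1)"
proof -
  let ?e = "Poly_Mapping.single i (1::nat)"
  let ?f = "\<lambda>k. Poly_Mapping.lookup (Poly_Mapping.single (k - ?e)
      (of_nat (Poly_Mapping.lookup k i) * Poly_Mapping.lookup p k)) m"
  \<comment> \<open>Subtraction of exponents is truncated: if x_i does not occur in
    \<open>k\<close>, then \<open>k - ?e\<close> is \<open>k\<close> itself, but its coefficient
    carries the factor 0.\<close>
  have "?f k = (if k = m + ?e
      then of_nat (Suc (Poly_Mapping.lookup m i)) * Poly_Mapping.lookup p (m + ?e) else 0)" for k
  proof (cases "Poly_Mapping.lookup k i = 0")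
    case True
    then show ?thesis by (auto simp: lookup_add)
  next
    case False
    then have "k - ?e + ?e = k"
      by (intro poly_mapping_eqI) (auto simp: lookup_add lookup_minus lookup_single when_def)
    then have "k - ?e = m \<longleftrightarrow> k = m + ?e" by auto
    then show ?thesis by (auto simp: lookup_single when_def lookup_add)
  qed
  then have "Poly_Mapping.lookup (pdiff i p) m = (\<Sum>k\<in>Poly_Mapping.keys p. if k = m + ?e
      then of_nat (Suc (Poly_Mapping.lookup m i)) * Poly_Mapping.lookup p (m + ?e) else 0)"
    by (simp add: pdiff_def lookup_sum)
  then show ?thesis by (simp add: sum.delta in_keys_iff)
qed

lemma at0_pdiff: "at0 (pdiff i p) = Poly_Mapping.lookup p (Poly_Mapping.single i 1)"
  by (simp add: at0_def lookup_pdiff)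

lemma pdiff_add: "pdiff i (p + q) = pdiff i p + pdiff i q"
  by (intro poly_mapping_eqI) (simp add: lookup_pdiff lookup_add algebra_simps)

lemma pdiff_mconst [simp]: "pdiff i (mconst c) = 0"
  by (intro poly_mapping_eqI)
    (auto simp: lookup_pdiff mconst_def lookup_single when_def)

lemma pdiff_single:
  "pdiff i (Poly_Mapping.single m c) =
    Poly_Mapping.single (m - Poly_Mapping.single i 1) (of_nat (Poly_Mapping.lookup m i) * c)"
  by (auto simp: pdiff_def)

lemma pdiff_mvar: "pdiff i (mvar j) = (if i = j then 1 else 0)"
  by (simp add: mvar_def pdiff_single lookup_single when_def)

lemma pdiff_mult: "pdiff i (p * q) = pdiff i p * q + p * pdiff i q"
proof (induction p rule: poly_mapping_add_induct)
  case (single k c)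
  show ?case
  proof (induction q rule: poly_mapping_add_induct)
    case (single k' c')
    let ?e = "Poly_Mapping.single i (1::nat)"
    \<comment> \<open>Moving the truncated subtraction onto one summand is wrong only when that
      summand has no x_i, and then both coefficients vanish.\<close>
    have "Poly_Mapping.single (k + k' - ?e) (of_nat (Poly_Mapping.lookup k i) * c * c')
        = Poly_Mapping.single (k - ?e + k') (of_nat (Poly_Mapping.lookup k i) * c * c')"
      for k k' :: "'a \<Rightarrow>\<^sub>0 nat" and c c' :: 'b
    proof (cases "Poly_Mapping.lookup k i = 0")
      case False
      then have "k + k' - ?e = k - ?e + k'"
        by (intro poly_mapping_eqI) (auto simp: lookup_add lookup_minus lookup_single when_def)
      then show ?thesis by simp
    qed simp
    from this[of k k' c c'] this[of k' k c' c] show ?case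
      by (simp add: pdiff_single mult_single lookup_add distrib_left distrib_right
          algebra_simps single_add)
  qed (simp add: algebra_simps pdiff_add)
qed (simp add: algebra_simps pdiff_add)

lemma pdiff_sum: "pdiff i (sum f A) = (\<Sum>x\<in>A. pdiff i (f x))"
  by (induction A rule: infinite_finite_induct)
    (simp_all add: pdiff_add flip: mconst_simps(1))

section \<open>Substitution, the algebra endomorphism sending each x_i to f_i\<close>

definition psubst :: "('n \<Rightarrow> ('n, 'a::comm_ring_1) mpoly) \<Rightarrow> ('n::finite, 'a) mpoly \<Rightarrow> ('n, 'a) mpoly" where
  "psubst f p = (\<Sum>m\<in>Poly_Mapping.keys p. mconst (Poly_Mapping.lookup p m) * (\<Prod>i\<in>UNIV. f i ^ Poly_Mapping.lookup m i))"

lemma psubst_single: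
  "psubst f (Poly_Mapping.single m c) = mconst c * (\<Prod>i\<in>UNIV. f i ^ Poly_Mapping.lookup m i)"
  by (auto simp: psubst_def)

lemma psubst_add: "psubst f (p + q) = psubst f p + psubst f q"
  unfolding psubst_def
  by (rule setsum_keys_plus_distrib) (simp_all add: mconst_add algebra_simps)

lemma psubst_mult: "psubst f (p * q) = psubst f p * psubst f q"
proof (induction p rule: poly_mapping_add_induct)
  case (single k c)
  show ?case
  proof (induction q rule: poly_mapping_add_induct)
    case (single k' c')
    then show ?case
      by (simp add: mult_single psubst_single lookup_add power_add prod.distrib mconst_mult)
  qed (simp add: algebra_simps psubst_add)
qed (simp add: algebra_simps psubst_add)

lemma psubst_mconst [simp]: "psubst f (mconst c) = mconst c"
  using psubst_single[of f 0 c] by (simp flip: mconst_def)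

lemma psubst_mvar [simp]: "psubst f (mvar i) = f i"
proof -
  have "(\<Prod>j\<in>UNIV. f j ^ (1 when i = j)) = (\<Prod>j\<in>UNIV. if j = i then f j else 1)"
    by (intro prod.cong) auto
  then show ?thesis
    by (simp add: mvar_def psubst_single lookup_single)
qed

lemma psubst_sum: "psubst f (sum g A) = (\<Sum>x\<in>A. psubst f (g x))"
  by (induction A rule: infinite_finite_induct)
    (simp_all add: psubst_add flip: mconst_simps(1))

lemma psubst_psubst: "psubst f (psubst g p) = psubst (\<lambda>i. psubst f (g i)) p"
  by (induction p rule: mpoly_induct) (simp_all add: psubst_add psubst_mult)

lemma psubst_mvar_id: "psubst mvar p = p"
  by (induction p rule: mpoly_induct) (simp_all add: psubst_add psubst_mult)

text \<open>Chain rule. Both sides are additive and satisfy the product rule twisted by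
  \<open>psubst f\<close>, so they agree once they agree on constants and variables.\<close>

lemma pdiff_psubst:
  "pdiff j (psubst f p) = (\<Sum>k\<in>UNIV. psubst f (pdiff k p) * pdiff j (f k))"
proof (induction p rule: mpoly_induct)
  case (mconst c)
  have "psubst f 0 = 0" using psubst_mconst[of f 0] by simp
  then show ?case by simp
next
  case (mvar i)
  have "psubst f (pdiff k (mvar i)) = (if k = i then 1 else 0)" for k
    using psubst_mconst[of f 0] psubst_mconst[of f 1] by (simp add: pdiff_mvar)
  then have "psubst f (pdiff k (mvar i)) * pdiff j (f k) = (if k = i then pdiff j (f i) else 0)" for k
    by simp
  then show ?case by simp
next
  case (add p q)
  then show ?case by (simp add: pdiff_add psubst_add distrib_right sum.distrib)
next
  case (mult p q)
  then show ?case
    by (simp add: pdiff_mult psubst_add psubst_mult algebra_simps sum.distrib sum_distrib_left)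
qed

text \<open>The determinant is an integer polynomial in the entries, so every unital ring
  homomorphism commutes with it. The instances are evaluation at 0, substitution and the inclusion
  of constants.\<close>

lemma det_hom:
  fixes h :: "'a::comm_ring_1 \<Rightarrow> 'b::comm_ring_1" and A :: "'a^'n^'n"
  assumes "h 1 = 1" and add: "\<And>x y. h (x + y) = h x + h y" and mult: "\<And>x y. h (x * y) = h x * h y"
  shows "h (det A) = det (\<chi> i j. h (A $ i $ j))"
proof -
  have h0: "h 0 = 0" using add[of 0 0] by simp
  have hneg: "h (- x) = - h x" for x
    using add[of x "- x"] h0 by (simp add: eq_neg_iff_add_eq_0 add.commute)
  have hsum: "h (sum f S) = (\<Sum>x\<in>S. h (f x))" for f :: "('n \<Rightarrow> 'n) \<Rightarrow> 'a" and S
    by (induction S rule: infinite_finite_induct) (simp_all add: h0 add)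
  have hprod: "h (prod f S) = (\<Prod>x\<in>S. h (f x))" for f :: "'n \<Rightarrow> 'a" and S
    by (induction S rule: infinite_finite_induct) (simp_all add: assms(1) mult)
  have "h (of_int (sign p)) = of_int (sign p)" for p :: "'n \<Rightarrow> 'n"
    by (simp add: sign_def assms(1) hneg)
  then show ?thesis by (simp add: det_def hsum mult hprod)
qed

lemma det_at0: "at0 (det A) = det (\<chi> i j. at0 (A $ i $ j))"
  by (rule det_hom) (simp_all add: at0_add at0_mult)

lemma det_psubst: "psubst f (det A) = det (\<chi> i j. psubst f (A $ i $ j))"
  by (rule det_hom) (simp_all add: psubst_add psubst_mult psubst_mconst[of f 1, simplified])

lemma det_mconst: "mconst (det A) = det (\<chi> i j. mconst (A $ i $ j))"
  by (rule det_hom) (simp_all add: mconst_add mconst_mult)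

section \<open>Weights and leading coefficients\<close>

definition weight :: "('n::finite \<Rightarrow> int) \<Rightarrow> ('n \<Rightarrow>\<^sub>0 nat) \<Rightarrow> int" where
  "weight w m = (\<Sum>j\<in>UNIV. w j * int (Poly_Mapping.lookup m j))"

lemma weight_add: "weight w (m + m') = weight w m + weight w m'"
  by (simp add: weight_def lookup_add distrib_left sum.distrib)

lemma weight_0 [simp]: "weight w 0 = 0"
  by (simp add: weight_def)

lemma weight_single [simp]: "weight w (Poly_Mapping.single j n) = w j * int n"
proof -
  have "w k * int (n when j = k) = (if k = j then w j * int n else 0)" for k
    by auto
  then show ?thesis by (simp add: weight_def lookup_single)
qed

lemma weight_1: "weight (\<lambda>_. 1) m = int (mdeg m)"
  by (simp add: weight_def mdeg_def)

lemma weight_linear: "weight (\<lambda>j. a * v j + b * u j) m = a * weight v m + b * weight u m"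
  by (simp add: weight_def sum_distrib_left distrib_right sum.distrib mult.assoc)

text \<open>This is the value at (1,...,1) of the part of weight \<open>d\<close>. Collapsing that
  part to one scalar keeps leading coefficients in the ground ring.\<close>

definition wcoeff :: "('n::finite \<Rightarrow> int) \<Rightarrow> int \<Rightarrow> ('n, 'a::comm_monoid_add) mpoly \<Rightarrow> 'a" where
  "wcoeff w d p = (\<Sum>m\<in>Poly_Mapping.keys p. Poly_Mapping.lookup p m when weight w m = d)"

lemma wcoeff_add: "wcoeff w d (p + q) = wcoeff w d p + wcoeff w d q"
  unfolding wcoeff_def by (rule setsum_keys_plus_distrib) (simp_all add: when_add_distrib)

lemma wcoeff_single: "wcoeff w d (Poly_Mapping.single m c) = (c when weight w m = d)"
  by (auto simp: wcoeff_def)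

lemma wcoeff_neq_0: "wcoeff w d p \<noteq> 0 \<Longrightarrow> \<exists>m\<in>Poly_Mapping.keys p. weight w m = d"
  unfolding wcoeff_def by (rule ccontr) (auto simp: when_def)

text \<open>As \<open>d\<close> and \<open>e\<close> bound the weights of the factors, a product of
  terms reaches weight \<open>d + e\<close> only if both terms attain their bound.\<close>

lemma wcoeff_mult:
  fixes p q :: "('n::finite, 'a::comm_semiring_0) mpoly"
  assumes "\<forall>m\<in>Poly_Mapping.keys p. weight w m \<le> d" "\<forall>m\<in>Poly_Mapping.keys q. weight w m \<le> e"
  shows "wcoeff w (d + e) (p * q) = wcoeff w d p * wcoeff w e q"
proof -
  have wsum: "wcoeff w k (sum f A) = (\<Sum>x\<in>A. wcoeff w k (f x))"
    for k and f :: "('n \<Rightarrow>\<^sub>0 nat) \<Rightarrow> ('n, 'a) mpoly" and A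
    by (induction A rule: infinite_finite_induct) (simp_all add: wcoeff_add, simp_all add: wcoeff_def)
  have expand: "r = (\<Sum>m\<in>Poly_Mapping.keys r. Poly_Mapping.single m (Poly_Mapping.lookup r m))"
    for r :: "('n, 'a) mpoly"
    by (intro poly_mapping_eqI) (auto simp: lookup_sum lookup_single when_def in_keys_iff)
  let ?p = "Poly_Mapping.lookup p" and ?q = "Poly_Mapping.lookup q"
  have "p * q = (\<Sum>m\<in>Poly_Mapping.keys p. \<Sum>m'\<in>Poly_Mapping.keys q.
      Poly_Mapping.single (m + m') (?p m * ?q m'))"
    by (subst (1) expand[of p], subst (1) expand[of q]) (simp add: sum_product mult_single)
  then have "wcoeff w (d + e) (p * q) = (\<Sum>m\<in>Poly_Mapping.keys p. \<Sum>m'\<in>Poly_Mapping.keys q.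
      (?p m * ?q m' when weight w m + weight w m' = d + e))"
    by (simp add: wsum wcoeff_single weight_add)
  also have "\<dots> = (\<Sum>m\<in>Poly_Mapping.keys p. \<Sum>m'\<in>Poly_Mapping.keys q.
      (?p m when weight w m = d) * (?q m' when weight w m' = e))"
  proof (intro sum.cong refl)
    fix m m' assume "m \<in> Poly_Mapping.keys p" "m' \<in> Poly_Mapping.keys q"
    with assms have "weight w m \<le> d" "weight w m' \<le> e" by auto
    then show "(?p m * ?q m' when weight w m + weight w m' = d + e)
        = (?p m when weight w m = d) * (?q m' when weight w m' = e)"
      by (auto simp: when_def)
  qed
  also have "\<dots> = wcoeff w d p * wcoeff w e q"
    by (simp add: wcoeff_def sum_product)
  finally show ?thesis .
qed

text \<open>The weight \<^term>\<open>d\<close> in \<open>wtop w d c p\<close> need not be attained: then \<^term>\<open>c\<close> is 0.\<close>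
definition wtop :: "('n::finite \<Rightarrow> int) \<Rightarrow> int \<Rightarrow> 'a \<Rightarrow> ('n, 'a::comm_ring_1) mpoly \<Rightarrow> bool" where
  "wtop w d c p \<longleftrightarrow> (\<forall>m\<in>Poly_Mapping.keys p. weight w m \<le> d) \<and> wcoeff w d p = c"

lemma wtop_0: "wtop w d 0 0"
  by (simp add: wtop_def wcoeff_def)

lemma wtop_mconst: "wtop w 0 c (mconst c)"
  by (auto simp: wtop_def wcoeff_single mconst_def)

lemma wtop_add: "wtop w d c p \<Longrightarrow> wtop w d c' q \<Longrightarrow> wtop w d (c + c') (p + q)"
  using keys_add[of p q] by (auto simp: wtop_def wcoeff_add)

lemma wtop_mult: "wtop w d c p \<Longrightarrow> wtop w e c' q \<Longrightarrow> wtop w (d + e) (c * c') (p * q)"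
  using keys_mult[of p q] by (force simp: wtop_def wcoeff_mult weight_add intro: add_mono)

lemma wtop_sum:
  "(\<And>x. x \<in> A \<Longrightarrow> wtop w d (c x) (p x)) \<Longrightarrow> wtop w d (\<Sum>x\<in>A. c x) (\<Sum>x\<in>A. p x)"
  by (induction A rule: infinite_finite_induct) (auto simp: wtop_0 intro!: wtop_add)

lemma wtop_prod:
  "(\<And>x. x \<in> A \<Longrightarrow> wtop w (d x) (c x) (p x)) \<Longrightarrow> wtop w (\<Sum>x\<in>A. d x) (\<Prod>x\<in>A. c x) (\<Prod>x\<in>A. p x)"
proof (induction A rule: infinite_finite_induct)
  case (infinite A)
  then show ?case using wtop_mconst[of w 1] by simp
next
  case empty
  then show ?case using wtop_mconst[of w 1] by simp
next
  case (insert x A)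
  then show ?case by (simp add: wtop_mult)
qed

text \<open>With entry bounds of the form \<open>d i - e j\<close>, every permutation contributes a
  product bounded by the same total weight. Hence the leading coefficients of the entries assemble
  to a determinant again.\<close>

lemma wtop_det:
  fixes M :: "('n::finite, 'a::comm_ring_1) mpoly ^'m^'m"
  assumes "\<And>i j. wtop w (d i - e j) (C $ i $ j) (M $ i $ j)"
  shows "wtop w ((\<Sum>i\<in>UNIV. d i) - (\<Sum>j\<in>UNIV. e j)) (det C) (det M)"
  unfolding det_def
proof (rule wtop_sum)
  fix p :: "'m \<Rightarrow> 'm" assume "p \<in> {p. p permutes UNIV}"
  then have "(\<Sum>i\<in>UNIV. e (p i)) = (\<Sum>j\<in>UNIV. e j)"
    by (simp add: sum.permute[of p UNIV e] o_def)
  then have deg: "(\<Sum>i\<in>UNIV. d i - e (p i)) = (\<Sum>i\<in>UNIV. d i) - (\<Sum>j\<in>UNIV. e j)"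
    by (simp add: sum_subtractf)
  have "wtop w (0 + (\<Sum>i\<in>UNIV. d i - e (p i))) (of_int (sign p) * (\<Prod>i\<in>UNIV. C $ i $ p i))
      (mconst (of_int (sign p)) * (\<Prod>i\<in>UNIV. M $ i $ p i))"
    by (intro wtop_mult wtop_mconst wtop_prod assms)
  then show "wtop w ((\<Sum>i\<in>UNIV. d i) - (\<Sum>j\<in>UNIV. e j))
      (of_int (sign p) * (\<Prod>i\<in>UNIV. C $ i $ p i)) (of_int (sign p) * (\<Prod>i\<in>UNIV. M $ i $ p i))"
    by (simp add: deg mconst_def)
qed

definition wlead :: "('n::finite \<Rightarrow> int) \<Rightarrow> ('n \<Rightarrow>\<^sub>0 nat) \<Rightarrow> ('n, 'a::zero) mpoly \<Rightarrow> bool" where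
  "wlead w a p \<longleftrightarrow> a \<in> Poly_Mapping.keys p \<and> (\<forall>m\<in>Poly_Mapping.keys p. m \<noteq> a \<longrightarrow> weight w m < weight w a)"

lemma wlead_wtop:
  assumes "wlead w a p"
  shows "wtop w (weight w a) (Poly_Mapping.lookup p a) p"
proof -
  have "wcoeff w (weight w a) p = (\<Sum>m\<in>Poly_Mapping.keys p. if m = a then Poly_Mapping.lookup p a else 0)"
    unfolding wcoeff_def using assms by (intro sum.cong) (auto simp: wlead_def when_def)
  with assms show ?thesis by (auto simp: wtop_def wlead_def sum.delta intro: less_imp_le)
qed

text \<open>Differentiation shifts exponents by a unit vector, so only the term at \<open>a\<close>
  can reach weight \<open>weight w a - w j\<close>. If x_j does not occur in \<open>a\<close>, that
  weight is not attained and the stated coefficient is 0.\<close>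

lemma wtop_pdiff:
  assumes "wlead w a p"
  shows "wtop w (weight w a - w j) (Poly_Mapping.lookup p a * of_nat (Poly_Mapping.lookup a j)) (pdiff j p)"
proof -
  let ?e = "Poly_Mapping.single j (1::nat)"
  have keys: "m + ?e \<in> Poly_Mapping.keys p" if "m \<in> Poly_Mapping.keys (pdiff j p)" for m
    using that by (auto simp: in_keys_iff lookup_pdiff)
  then have bound: "weight w m \<le> weight w a - w j" if "m \<in> Poly_Mapping.keys (pdiff j p)" for m
    using assms that by (force simp: wlead_def weight_add)
  have eq: "m + ?e = a" if "m \<in> Poly_Mapping.keys (pdiff j p)" "weight w m = weight w a - w j" for m
    using assms keys[OF that(1)] that(2) by (force simp: wlead_def weight_add)
  have "wcoeff w (weight w a - w j) (pdiff j p) = Poly_Mapping.lookup p a * of_nat (Poly_Mapping.lookup a j)"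
  proof (cases "Poly_Mapping.lookup a j = 0")
    case True
    have "weight w m \<noteq> weight w a - w j" if "m \<in> Poly_Mapping.keys (pdiff j p)" for m
      using eq[OF that] True by (auto simp: lookup_add)
    then show ?thesis using True by (simp add: wcoeff_def)
  next
    case False
    define b where "b = a - ?e"
    have b: "b + ?e = a"
      using False unfolding b_def
      by (intro poly_mapping_eqI) (auto simp: lookup_add lookup_minus lookup_single when_def)
    have wb: "weight w b = weight w a - w j"
      by (simp flip: b add: weight_add)
    have "wcoeff w (weight w a - w j) (pdiff j p) =
        (\<Sum>m\<in>Poly_Mapping.keys (pdiff j p). if m = b then Poly_Mapping.lookup (pdiff j p) b else 0)"
      unfolding wcoeff_def using eq b wb by (intro sum.cong) (auto simp: when_def)
    also have "\<dots> = Poly_Mapping.lookup (pdiff j p) b"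
      by (simp add: sum.delta in_keys_iff)
    also have "Suc (Poly_Mapping.lookup b j) = Poly_Mapping.lookup a j"
      by (simp flip: b add: lookup_add)
    then have "Poly_Mapping.lookup (pdiff j p) b = Poly_Mapping.lookup p a * of_nat (Poly_Mapping.lookup a j)"
      by (simp only: lookup_pdiff b mult.commute)
    finally show ?thesis .
  qed
  with bound show ?thesis by (simp add: wtop_def)
qed

text \<open>Multiplication by x_i translates all exponents by one vector, which preserves strict
  comparisons of weights.\<close>

lemma wlead_mult_mvar:
  fixes p :: "('n::finite, 'a::comm_ring_1) mpoly"
  assumes "wlead w a p"
  shows "wlead w (Poly_Mapping.single i 1 + a) (mvar i * p)"
    and "Poly_Mapping.lookup (mvar i * p) (Poly_Mapping.single i 1 + a) = Poly_Mapping.lookup p a"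
proof -
  have lookup: "Poly_Mapping.lookup (mvar i * p) (Poly_Mapping.single i 1 + m) = Poly_Mapping.lookup p m" for m
    by (simp add: mvar_def lookup_single_add_mult del: One_nat_def)
  show "Poly_Mapping.lookup (mvar i * p) (Poly_Mapping.single i 1 + a) = Poly_Mapping.lookup p a"
    by (rule lookup)
  have "\<exists>m'\<in>Poly_Mapping.keys p. m = Poly_Mapping.single i 1 + m'" if "m \<in> Poly_Mapping.keys (mvar i * p)" for m
    using that keys_mult[of "mvar i" p] by (auto simp: mvar_def split: if_splits)
  with assms show "wlead w (Poly_Mapping.single i 1 + a) (mvar i * p)"
    by (force simp: wlead_def in_keys_iff lookup weight_add simp del: One_nat_def)
qed

text \<open>Provides a weight in general position: it separates any two vectors from a bounded box.
  It serves to break ties between exponents and between rays.\<close>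

lemma ex_generic_weight:
  "\<exists>v :: 'n::finite \<Rightarrow> int. \<forall>f g :: 'n \<Rightarrow> nat. (\<forall>j. f j < N) \<longrightarrow> (\<forall>j. g j < N)
     \<longrightarrow> (\<Sum>j\<in>UNIV. v j * int (f j)) = (\<Sum>j\<in>UNIV. v j * int (g j)) \<longrightarrow> f = g"
proof -
  have "\<exists>v :: 'n \<Rightarrow> int. \<forall>f g :: 'n \<Rightarrow> nat. (\<forall>j. f j < N) \<longrightarrow> (\<forall>j. g j < N)
      \<longrightarrow> (\<Sum>j\<in>A. v j * int (f j)) = (\<Sum>j\<in>A. v j * int (g j)) \<longrightarrow> (\<forall>j\<in>A. f j = g j)"
    if "finite A" for A
    using that
  proof induction
    case (insert a A)
    then obtain v :: "'n \<Rightarrow> int" where v: "\<And>f g :: 'n \<Rightarrow> nat. (\<forall>j. f j < N) \<Longrightarrow> (\<forall>j. g j < N)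
        \<Longrightarrow> (\<Sum>j\<in>A. v j * int (f j)) = (\<Sum>j\<in>A. v j * int (g j)) \<Longrightarrow> (\<forall>j\<in>A. f j = g j)"
      by blast
    (* digits in base N *)
    define u where "u = (\<lambda>j. if j = a then 1 else int N * v j)"
    have u: "(\<Sum>j\<in>insert a A. u j * int (f j)) = int (f a) + int N * (\<Sum>j\<in>A. v j * int (f j))"
      for f :: "'n \<Rightarrow> nat"
    proof -
      have "(\<Sum>j\<in>A. u j * int (f j)) = (\<Sum>j\<in>A. int N * (v j * int (f j)))"
        using insert by (intro sum.cong) (auto simp: u_def)
      with insert show ?thesis by (simp add: u_def sum_distrib_left)
    qed
    show ?case
    proof (intro exI[of _ u] allI impI)
      fix f g :: "'n \<Rightarrow> nat"
      assume f: "\<forall>j. f j < N" and g: "\<forall>j. g j < N"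
        and eq: "(\<Sum>j\<in>insert a A. u j * int (f j)) = (\<Sum>j\<in>insert a A. u j * int (g j))"
      let ?s = "\<lambda>f :: 'n \<Rightarrow> nat. \<Sum>j\<in>A. v j * int (f j)"
      have eq': "int (f a) + int N * ?s f = int (g a) + int N * ?s g"
        using eq by (simp only: u)
      then have "(int (f a) + int N * ?s f) mod int N = (int (g a) + int N * ?s g) mod int N"
        by simp
      then have "f a = g a" using f g by simp
      \<comment> \<open>The bound on \<open>f\<close> also shows that \<open>N\<close> is positive,
        which allows it to be cancelled.\<close>
      with eq' f have "?s f = ?s g" by auto
      with v f g \<open>f a = g a\<close> show "\<forall>j\<in>insert a A. f j = g j" by blast
    qed
  qed simp
  from this[of UNIV] show ?thesis by (simp flip: fun_eq_iff)
qed

section \<open>Total degree\<close>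

lemma mdeg_add: "mdeg (m + m') = mdeg m + mdeg m'"
  by (simp add: mdeg_def lookup_add sum.distrib)

lemma mdeg_single [simp]: "mdeg (Poly_Mapping.single j n) = n"
  using weight_1[of "Poly_Mapping.single j n"] by simp

lemma lookup_le_mdeg: "Poly_Mapping.lookup m j \<le> mdeg m"
  unfolding mdeg_def by (rule member_le_sum) auto

lemma mdeg_eq_0_iff [simp]: "mdeg m = 0 \<longleftrightarrow> m = 0"
  by (auto simp: mdeg_def poly_mapping_eq_iff fun_eq_iff)

lemma mdeg_0 [simp]: "mdeg 0 = 0"
  by simp

lemma mdeg_pos_iff [simp]: "0 < mdeg m \<longleftrightarrow> m \<noteq> 0"
  by (metis mdeg_eq_0_iff neq0_conv)

lemma mdeg_le_1_cases:
  assumes "mdeg m \<le> 1"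
  obtains "m = 0" | j where "m = Poly_Mapping.single j 1"
proof (cases "m = 0")
  case False
  then obtain j where "Poly_Mapping.lookup m j \<noteq> 0"
    by (auto simp: poly_mapping_eq_iff fun_eq_iff)
  then have "m = Poly_Mapping.single j 1 + (m - Poly_Mapping.single j 1)"
    by (intro poly_mapping_eqI) (auto simp: lookup_add lookup_minus lookup_single when_def)
  with assms have "mdeg (m - Poly_Mapping.single j 1) = 0"
    by (metis add_le_same_cancel1 le_zero_eq mdeg_add mdeg_single)
  with \<open>m = _\<close> that(2) show thesis by simp
qed (rule that(1))

lemma mdeg_le_tdeg: "m \<in> Poly_Mapping.keys p \<Longrightarrow> mdeg m \<le> tdeg p"
  by (auto simp: tdeg_def)

lemma keys_nonempty: "p \<noteq> 0 \<Longrightarrow> Poly_Mapping.keys p \<noteq> {}"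
  by (auto simp: poly_mapping_eq_iff fun_eq_iff in_keys_iff)

lemma tdeg_attained:
  assumes "p \<noteq> 0"
  obtains m where "m \<in> Poly_Mapping.keys p" "mdeg m = tdeg p"
proof -
  have "tdeg p \<in> mdeg ` Poly_Mapping.keys p"
    using assms keys_nonempty[OF assms] by (auto simp: tdeg_def intro!: Max_in)
  with that show thesis by auto
qed

lemma tdeg_eqI:
  assumes "m \<in> Poly_Mapping.keys p" "\<And>m'. m' \<in> Poly_Mapping.keys p \<Longrightarrow> mdeg m' \<le> mdeg m"
  shows "tdeg p = mdeg m"
  using assms mdeg_le_tdeg[OF assms(1)] tdeg_attained[of p]
  by (metis in_keys_iff le_antisym lookup_zero)

lemma tdeg_mconst [simp]: "tdeg (mconst c) = 0"
  by (auto simp: tdeg_def mconst_def)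

lemma tdeg_0_imp_mconst:
  assumes "tdeg p = 0"
  shows "p = mconst (at0 p)"
proof (rule poly_mapping_eqI)
  fix m
  show "Poly_Mapping.lookup p m = Poly_Mapping.lookup (mconst (at0 p)) m"
    using mdeg_le_tdeg[of m p] assms
    by (cases "m = 0") (auto simp: mconst_def at0_def lookup_single in_keys_iff)
qed

text \<open>Ties are excluded only at the maximal weight. This weak form matters for a weight that
  separates exponents along a single ray and not elsewhere.\<close>

lemma wlead_exists:
  assumes "p \<noteq> 0"
    and "\<And>m m'. m \<in> Poly_Mapping.keys p \<Longrightarrow> m' \<in> Poly_Mapping.keys p
      \<Longrightarrow> weight w m = weight w m' \<Longrightarrow> (\<forall>k\<in>Poly_Mapping.keys p. weight w k \<le> weight w m) \<Longrightarrow> m = m'"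
  obtains a where "wlead w a p"
proof -
  let ?M = "Max (weight w ` Poly_Mapping.keys p)"
  have "?M \<in> weight w ` Poly_Mapping.keys p"
    using keys_nonempty[OF assms(1)] by (intro Max_in) auto
  then obtain a where a: "a \<in> Poly_Mapping.keys p" "weight w a = ?M" by auto
  then have max: "\<forall>k\<in>Poly_Mapping.keys p. weight w k \<le> weight w a" by simp
  have "weight w m < weight w a" if "m \<in> Poly_Mapping.keys p" "m \<noteq> a" for m
    using max a(1) that assms(2)[of a m] by (metis order.not_eq_order_implies_strict)
  with a(1) show thesis by (intro that[of a]) (simp add: wlead_def)
qed

text \<open>The product of the leading terms for a degree-compatible total order on exponents cannot
  cancel over a domain.\<close>

lemma tdeg_mult:
  fixes p q :: "('n::finite, 'a::idom) mpoly"
  assumes "p \<noteq> 0" "q \<noteq> 0"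
  shows "tdeg (p * q) = tdeg p + tdeg q"
proof -
  let ?D = "tdeg p + tdeg q"
  obtain v :: "'n \<Rightarrow> int" where v: "\<And>f g :: 'n \<Rightarrow> nat. (\<forall>j. f j < Suc ?D) \<Longrightarrow> (\<forall>j. g j < Suc ?D)
     \<Longrightarrow> (\<Sum>j\<in>UNIV. v j * int (f j)) = (\<Sum>j\<in>UNIV. v j * int (g j)) \<Longrightarrow> f = g"
    using ex_generic_weight[of "Suc ?D"] by blast
  define S where "S = (\<Sum>j\<in>UNIV. \<bar>v j\<bar> * int ?D)"
  \<comment> \<open>Values of \<open>v\<close> on the relevant exponents differ by at most 2S, so
    the factor 2S + 1 lets the degree decide first and \<open>v\<close> only break ties. The factors
    1 match \<open>weight_linear\<close>.\<close>
  define w where "w = (\<lambda>j. 1 * v j + (2 * S + 1) * 1)"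
  have weight_w: "weight w m = weight v m + (2 * S + 1) * int (mdeg m)" for m
    unfolding w_def weight_linear by (simp add: weight_1)
  have small: "\<bar>weight v m\<bar> \<le> S" if "mdeg m \<le> ?D" for m
    unfolding weight_def S_def
  proof (intro order_trans[OF sum_abs] sum_mono)
    fix j
    have "Poly_Mapping.lookup m j \<le> ?D" using that lookup_le_mdeg[of m j] by linarith
    then show "\<bar>v j * int (Poly_Mapping.lookup m j)\<bar> \<le> \<bar>v j\<bar> * int ?D"
      by (simp add: abs_mult mult_left_mono flip: of_nat_add del: of_nat_add)
  qed
  have mono: "weight w m < weight w m'" if "mdeg m \<le> ?D" "mdeg m' \<le> ?D" "mdeg m < mdeg m'" for m m'
  proof -
    have "0 \<le> S" using small[OF that(1)] by linarith
    then have "(2 * S + 1) * int (Suc (mdeg m)) \<le> (2 * S + 1) * int (mdeg m')"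
      using that(3) by (intro mult_left_mono) auto
    then have "(2 * S + 1) * int (mdeg m) + (2 * S + 1) \<le> (2 * S + 1) * int (mdeg m')"
      by (simp add: algebra_simps)
    with small[OF that(1)] small[OF that(2)] show ?thesis by (simp add: weight_w abs_le_iff)
  qed
  have inj: "m = m'" if "mdeg m \<le> ?D" "mdeg m' \<le> ?D" "weight w m = weight w m'" for m m'
  proof -
    have "mdeg m = mdeg m'" using mono[of m m'] mono[of m' m] that by (cases "mdeg m" "mdeg m'" rule: linorder_cases) auto
    with that have "weight v m = weight v m'" by (simp add: weight_w)
    moreover have "Poly_Mapping.lookup m j < Suc ?D" "Poly_Mapping.lookup m' j < Suc ?D" for j
      using that lookup_le_mdeg[of m j] lookup_le_mdeg[of m' j] by linarith+
    ultimately have "Poly_Mapping.lookup m = Poly_Mapping.lookup m'"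
      by (intro v) (auto simp: weight_def)
    then show ?thesis by (rule poly_mapping_eq_iff[THEN iffD2])
  qed
  have keysp: "mdeg m \<le> ?D" if "m \<in> Poly_Mapping.keys p" for m
    using mdeg_le_tdeg[OF that] by simp
  have keysq: "mdeg m \<le> ?D" if "m \<in> Poly_Mapping.keys q" for m
    using mdeg_le_tdeg[OF that] by simp
  obtain a where a: "wlead w a p"
    using wlead_exists[OF assms(1)] inj keysp by metis
  obtain b where b: "wlead w b q"
    using wlead_exists[OF assms(2)] inj keysq by metis
  have da: "mdeg a = tdeg p"
    using a keysp mono[of a] by (intro tdeg_eqI[symmetric]) (force simp: wlead_def not_le)+
  have db: "mdeg b = tdeg q"
    using b keysq mono[of b] by (intro tdeg_eqI[symmetric]) (force simp: wlead_def not_le)+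
  have keys: "mdeg m \<le> ?D" if "m \<in> Poly_Mapping.keys (p * q)" for m
    using that keys_mult[of p q] by (fastforce simp: mdeg_add intro: add_mono mdeg_le_tdeg)
  \<comment> \<open>A nonzero coefficient in this weight yields an exponent of the product, and
    injectivity of the weight identifies it as \<open>a + b\<close>.\<close>
  have "wcoeff w (weight w (a + b)) (p * q) = Poly_Mapping.lookup p a * Poly_Mapping.lookup q b"
    using wtop_mult[OF wlead_wtop[OF a] wlead_wtop[OF b]] by (simp add: wtop_def weight_add)
  also have "\<dots> \<noteq> 0" using a b by (simp add: wlead_def in_keys_iff)
  finally obtain m where "m \<in> Poly_Mapping.keys (p * q)" "weight w m = weight w (a + b)"
    using wcoeff_neq_0 by blast
  moreover from this have "m = a + b"
    by (intro inj) (auto simp: mdeg_add da db keys)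
  ultimately show ?thesis
    using tdeg_eqI[of "a + b" "p * q"] keys by (simp add: mdeg_add da db)
qed

section \<open>Units and irreducibility, by additivity of degrees\<close>

lemma mpoly_dvd_1_iff:
  fixes p :: "('n::finite, 'a::field) mpoly"
  shows "p dvd 1 \<longleftrightarrow> p \<noteq> 0 \<and> tdeg p = 0"
proof
  assume "p dvd 1"
  then obtain q where q: "1 = p * q" by (auto simp: dvd_def)
  then have nz: "p \<noteq> 0" "q \<noteq> 0" by auto
  moreover have "tdeg (mconst 1 :: ('n, 'a) mpoly) = 0" by (rule tdeg_mconst)
  ultimately have "tdeg p + tdeg q = 0"
    using tdeg_mult[of p q] q by simp
  with nz show "p \<noteq> 0 \<and> tdeg p = 0" by simp
next
  assume p: "p \<noteq> 0 \<and> tdeg p = 0"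
  then have "p = mconst (at0 p)" by (intro tdeg_0_imp_mconst) simp
  moreover from this p have "at0 p \<noteq> 0" by auto
  then have "mconst (at0 p) * mconst (inverse (at0 p)) = 1"
    by (simp flip: mconst_mult)
  ultimately show "p dvd 1" by (metis dvd_triv_left)
qed

lemma tdeg_1_imp_irreducible:
  fixes p :: "('n::finite, 'a::field) mpoly"
  assumes "tdeg p = 1"
  shows "irreducible p"
proof (rule irreducibleI)
  show "p \<noteq> 0" using assms by (auto simp: tdeg_def)
  show "\<not> p dvd 1" using assms by (simp add: mpoly_dvd_1_iff)
  fix a b assume "p = a * b"
  with \<open>p \<noteq> 0\<close> have "a \<noteq> 0" "b \<noteq> 0" by auto
  with tdeg_mult[of a b] \<open>p = a * b\<close> assms have "tdeg a = 0 \<or> tdeg b = 0" by simp arith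
  with \<open>a \<noteq> 0\<close> \<open>b \<noteq> 0\<close> show "a dvd 1 \<or> b dvd 1" by (auto simp: mpoly_dvd_1_iff)
qed

text \<open>The linear coefficients are written as partial derivatives at 0 so that they are the
  entries of \<open>const_jacobian\<close>.\<close>

lemma tdeg_le_1_expand:
  fixes p :: "('n::finite, 'a::comm_ring_1) mpoly"
  assumes "tdeg p \<le> 1"
  shows "p = mconst (at0 p) + (\<Sum>j\<in>UNIV. mconst (at0 (pdiff j p)) * mvar j)"
proof (rule poly_mapping_eqI)
  fix m
  have monom: "mconst c * mvar j = Poly_Mapping.single (Poly_Mapping.single j 1) c" for c :: 'a and j :: 'n
    by (simp add: mconst_def mvar_def mult_single)
  show "Poly_Mapping.lookup p m =
      Poly_Mapping.lookup (mconst (at0 p) + (\<Sum>j\<in>UNIV. mconst (at0 (pdiff j p)) * mvar j)) m"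
  proof (cases "mdeg m \<le> 1")
    case True
    then show ?thesis
    proof (cases rule: mdeg_le_1_cases)
      case 1
      then show ?thesis
        by (simp add: lookup_add lookup_sum monom lookup_single) (simp add: at0_def mconst_def)
    next
      case (2 k)
      have eq: "Poly_Mapping.single j (1::nat) = Poly_Mapping.single k 1 \<longleftrightarrow> j = k" for j
        by (metis lookup_single_eq lookup_single_not_eq zero_neq_one)
      have "Poly_Mapping.lookup (\<Sum>j\<in>UNIV. mconst (at0 (pdiff j p)) * mvar j) m =
          (\<Sum>j\<in>UNIV. if j = k then Poly_Mapping.lookup p m else 0)"
        unfolding lookup_sum monom 2 lookup_single eq by (intro sum.cong) (auto simp: at0_pdiff)
      moreover have "Poly_Mapping.lookup (mconst (at0 p)) m = 0"
        unfolding 2 mconst_def lookup_single by simp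
      ultimately show ?thesis by (simp add: lookup_add)
    qed
  next
    case False
    then have "m \<noteq> 0" "\<And>j. Poly_Mapping.single j 1 \<noteq> m" by auto
    then have "Poly_Mapping.lookup (mconst (at0 p) + (\<Sum>j\<in>UNIV. mconst (at0 (pdiff j p)) * mvar j)) m = 0"
      by (simp add: lookup_add lookup_sum monom lookup_single del: One_nat_def)
        (simp add: mconst_def lookup_single)
    moreover have "m \<notin> Poly_Mapping.keys p" using False assms mdeg_le_tdeg[of m p] by auto
    ultimately show ?thesis by (simp add: in_keys_iff)
  qed
qed

section \<open>Keller maps with linear factors\<close>

lemma det_nonzeroI:
  fixes A :: "'a::field^'n^'n"
  assumes "\<And>x. A *v x = 0 \<Longrightarrow> x = 0"
  shows "det A \<noteq> 0"
  using assms by (metis invertible_det_nz invertible_left_inverse matrix_left_invertible_ker)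

text \<open>The case L_i = x_i of 3) ==> 4). These coordinates make JF diagonal at the origin, which
  puts 0 among the exponents of every H_k.\<close>

lemma keller_mvar_mult_imp_mconst:
  fixes H :: "'n::finite \<Rightarrow> ('n, 'a::field_char_0) mpoly"
  assumes "keller (\<lambda>i. mvar i * H i)"
  shows "H i = mconst (at0 (H i))"
proof (rule ccontr)
  assume nonconst: "H i \<noteq> mconst (at0 (H i))"
  obtain c where c: "c \<noteq> 0" "det (jacobian (\<lambda>i. mvar i * H i)) = mconst c"
    using assms by (auto simp: keller_def)
  \<comment> \<open>At the origin only the summand delta_ij H_i of the derivative of x_i H_i
    survives, so \<open>c\<close> is the product of all H_i(0).\<close>
  have "c = det (\<chi> i j. at0 (pdiff j (mvar i * H i)))"
    using det_at0[of "jacobian (\<lambda>i. mvar i * H i)"] c by (simp add: jacobian_def)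
  also have "\<dots> = (\<Prod>i\<in>UNIV. at0 (H i))"
    by (subst det_diagonal) (auto simp: pdiff_mult pdiff_mvar at0_add at0_mult)
  finally have H0: "at0 (H k) \<noteq> 0" for k using c by simp
  define B where "B = (\<Union>k. Poly_Mapping.keys (H k))"
  have "finite B" by (simp add: B_def)
  have B: "m \<in> B" if "m \<in> Poly_Mapping.keys (H k)" for m k using that by (auto simp: B_def)
  have "\<exists>b\<in>Poly_Mapping.keys (H i). b \<noteq> 0"
  proof (rule ccontr)
    assume "\<not> ?thesis"
    then have "H i = mconst (at0 (H i))"
      by (intro poly_mapping_eqI) (auto simp: mconst_def at0_def lookup_single when_def in_keys_iff)
    with nonconst show False ..
  qed
  then have "B - {0} \<noteq> {}" using B by blast
  define D where "D = Max (mdeg ` B)"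
  have D: "mdeg m \<le> D" if "m \<in> B" for m using that \<open>finite B\<close> by (simp add: D_def)
  \<comment> \<open>The vectors to be separated are deg(b) m and deg(m) b with \<open>m\<close>,
    \<open>b\<close> in \<open>B\<close>; their entries are at most D * D.\<close>
  obtain v :: "'n \<Rightarrow> int" where v: "\<And>f g :: 'n \<Rightarrow> nat. (\<forall>j. f j < Suc (D * D)) \<Longrightarrow> (\<forall>j. g j < Suc (D * D))
     \<Longrightarrow> (\<Sum>j\<in>UNIV. v j * int (f j)) = (\<Sum>j\<in>UNIV. v j * int (g j)) \<Longrightarrow> f = g"
    using ex_generic_weight[of "Suc (D * D)"] by blast
  \<comment> \<open>The slope is constant along rays, and a maximizer \<open>b\<close> picks out an
    extreme ray. The exponent 0 lies on every ray and is left out.\<close>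
  define \<rho> where "\<rho> = (\<lambda>m. real_of_int (weight v m) / real (mdeg m))"
  have "Max (\<rho> ` (B - {0})) \<in> \<rho> ` (B - {0})"
    using \<open>finite B\<close> \<open>B - {0} \<noteq> {}\<close> by (intro Max_in) auto
  then obtain b where "b \<in> B - {0}" and bmax: "\<rho> b = Max (\<rho> ` (B - {0}))" by (metis imageE)
  then have b: "b \<in> B" "b \<noteq> 0" by auto
  \<comment> \<open>The difference of slopes \<open>\<rho> m - \<rho> b\<close> with denominators
    cleared. It is an integer linear form in the exponent, hence usable as a weight.\<close>
  define \<kappa> where "\<kappa> = (\<lambda>m. int (mdeg b) * weight v m - weight v b * int (mdeg m))"
  have \<kappa>: "\<kappa> m \<le> 0" if "m \<in> B" for m
  proof (cases "m = 0")
    case False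
    then have "\<rho> m \<le> \<rho> b" using bmax \<open>finite B\<close> that by simp
    moreover have "mdeg m > 0" "mdeg b > 0" using False b by simp_all
    ultimately have "real_of_int (weight v m) * real (mdeg b) \<le> real_of_int (weight v b) * real (mdeg m)"
      by (simp add: \<rho>_def field_simps)
    then have "real_of_int (weight v m * int (mdeg b)) \<le> real_of_int (weight v b * int (mdeg m))"
      by simp
    then show ?thesis unfolding \<kappa>_def of_int_le_iff by (simp add: mult.commute)
  qed (simp add: \<kappa>_def mdeg_def)
  \<comment> \<open>Vanishing of \<open>\<kappa> m\<close> means that \<open>v\<close> agrees on
    deg(b) m and deg(m) b. Genericity makes these vectors equal, so \<open>m\<close> lies on the ray
    of \<open>b\<close>.\<close>
  have parallel: "mdeg b * Poly_Mapping.lookup m j = mdeg m * Poly_Mapping.lookup b j"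
    if "m \<in> B" "\<kappa> m = 0" for m j
  proof -
    have bound: "mdeg k * Poly_Mapping.lookup k' j < Suc (D * D)" if "k \<in> B" "k' \<in> B" for k k' j
      using D[OF that(1)] D[OF that(2)] lookup_le_mdeg[of k' j]
      by (intro le_imp_less_Suc mult_le_mono) auto
    have "(\<lambda>j. mdeg b * Poly_Mapping.lookup m j) = (\<lambda>j. mdeg m * Poly_Mapping.lookup b j)"
    proof (rule v)
      have scale: "(\<Sum>j\<in>UNIV. v j * int (n * Poly_Mapping.lookup k j)) = int n * weight v k" for n k
        by (simp add: weight_def sum_distrib_left algebra_simps)
      show "(\<Sum>j\<in>UNIV. v j * int (mdeg b * Poly_Mapping.lookup m j)) =
          (\<Sum>j\<in>UNIV. v j * int (mdeg m * Poly_Mapping.lookup b j))"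
        unfolding scale using that(2) by (simp add: \<kappa>_def mult.commute)
    qed (use bound b that in auto)
    then show ?thesis by (rule fun_cong)
  qed
  (* The slopes weight v m / mdeg m are maximal exactly along the ray of b, so kappa vanishes there
     and is negative at the other nonzero exponents; the factor D + 1 makes this outweigh mdeg,
     which only orders the exponents along the ray. *)
  define w where "w = (\<lambda>j. (int D + 1) * (int (mdeg b) * v j + (- weight v b) * 1) + 1 * 1)"
  have weight_w: "weight w m = (int D + 1) * \<kappa> m + int (mdeg m)" for m
    unfolding w_def weight_linear by (simp add: weight_1 \<kappa>_def)
  have weight_nonneg: "\<kappa> m = 0" if "m \<in> B" "0 \<le> weight w m" for m
  proof (rule ccontr)
    assume "\<kappa> m \<noteq> 0"
    with \<kappa>[OF that(1)] have "(int D + 1) * \<kappa> m \<le> (int D + 1) * (-1)"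
      by (intro mult_left_mono) auto
    with that D[OF that(1)] show False by (simp add: weight_w)
  qed
  \<comment> \<open>The exponent 0 has weight 0, so the maximal weight in each H_k is nonnegative
    and can be attained only on the ray.\<close>
  have key0: "0 \<in> Poly_Mapping.keys (H k)" for k
    using H0[of k] by (simp add: in_keys_iff at0_def)
  have "\<exists>a. wlead w a (H k)" for k
  proof (rule wlead_exists)
    show "H k \<noteq> 0" using H0[of k] by auto
    fix m m'
    assume m: "m \<in> Poly_Mapping.keys (H k)" "m' \<in> Poly_Mapping.keys (H k)" "weight w m = weight w m'"
      and max: "\<forall>n\<in>Poly_Mapping.keys (H k). weight w n \<le> weight w m"
    from max key0[of k] have nonneg: "0 \<le> weight w m" by fastforce
    have "\<kappa> m = 0" "\<kappa> m' = 0" using m nonneg B weight_nonneg by auto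
    with m have "mdeg m = mdeg m'" by (simp add: weight_w)
    with parallel \<open>\<kappa> m = 0\<close> \<open>\<kappa> m' = 0\<close> m B have "mdeg b * Poly_Mapping.lookup m j = mdeg b * Poly_Mapping.lookup m' j" for j
      by metis
    with b show "m = m'" by (intro poly_mapping_eqI) simp
  qed blast
  then obtain a where a: "\<And>k. wlead w (a k) (H k)" by metis
  have a_nonneg: "0 \<le> weight w (a k)" for k
    using a[of k] key0[of k] by (cases "a k = 0") (force simp: wlead_def)+
  have aB: "a k \<in> B" for k using a[of k] B by (auto simp: wlead_def)
  \<comment> \<open>Some H_k contains \<open>b\<close>, whose weight is deg(b) > 0; this makes the
    total leading weight strictly positive.\<close>
  obtain k where k: "b \<in> Poly_Mapping.keys (H k)" using b by (auto simp: B_def)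
  have "\<kappa> b = 0" by (simp add: \<kappa>_def mult.commute)
  then have "0 < weight w b" using b by (simp add: weight_w)
  also have "weight w b \<le> weight w (a k)" using a[of k] k by (cases "b = a k") (auto simp: wlead_def)
  finally have pos: "0 < (\<Sum>k\<in>UNIV. weight w (a k))"
    using a_nonneg by (intro sum_pos2[of _ k]) auto
  \<comment> \<open>Leading coefficients of the entries of JF: x_i H_i has leading exponent e_i +
    a_i. In the total weight the contributions of the e_i cancel against those of the
    derivatives.\<close>
  define C :: "'a^'n^'n" where "C = (\<chi> i j. Poly_Mapping.lookup (H i) (a i) *
      of_nat (Poly_Mapping.lookup (Poly_Mapping.single i 1 + a i) j))"
  have "wtop w ((\<Sum>i\<in>UNIV. weight w (Poly_Mapping.single i 1 + a i)) - (\<Sum>j\<in>UNIV. w j))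
      (det C) (det (jacobian (\<lambda>i. mvar i * H i)))"
  proof (rule wtop_det)
    fix i j
    show "wtop w (weight w (Poly_Mapping.single i 1 + a i) - w j) (C $ i $ j)
        (jacobian (\<lambda>i. mvar i * H i) $ i $ j)"
      using wtop_pdiff[OF wlead_mult_mvar(1)[OF a[of i]], of i j]
      by (simp add: C_def jacobian_def wlead_mult_mvar(2)[OF a[of i]] del: One_nat_def)
  qed
  then have "wtop w (\<Sum>k\<in>UNIV. weight w (a k)) (det C) (mconst c)"
    by (simp add: c weight_add sum.distrib)
  \<comment> \<open>A constant has no terms of positive weight.\<close>
  with pos have "det C = 0" by (auto simp: wtop_def wcoeff_single mconst_def when_def)
  (* Up to row scaling, C is the identity plus a rank one matrix with nonnegative entries. *)
  moreover have "det C \<noteq> 0"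
  proof (rule det_nonzeroI)
    fix x assume "C *v x = 0"
    \<comment> \<open>The rank one part sends \<open>x\<close> to the vector with entries r_k s,
      where a_k = r_k b. A kernel vector is thus determined by the scalar \<open>s\<close>.\<close>
    define s where "s = (\<Sum>j\<in>UNIV. of_nat (Poly_Mapping.lookup b j) * x $ j)"
    let ?r = "\<lambda>k. of_nat (mdeg (a k)) / of_nat (mdeg b) :: 'a"
    have nb: "of_nat (mdeg b) \<noteq> (0 :: 'a)" using b by simp
    have x: "x $ k = - ?r k * s" for k
    proof -
      have lk: "Poly_Mapping.lookup (H k) (a k) \<noteq> 0" using a[of k] by (simp add: wlead_def in_keys_iff)
      have "0 = (C *v x) $ k" using \<open>C *v x = 0\<close> by simp
      also have "\<dots> = (\<Sum>j\<in>UNIV. Poly_Mapping.lookup (H k) (a k) *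
          ((if j = k then x $ k else 0) + of_nat (Poly_Mapping.lookup (a k) j) * x $ j))"
        by (auto simp: C_def matrix_vector_mult_def lookup_add lookup_single when_def algebra_simps intro!: sum.cong)
      also have "\<dots> = Poly_Mapping.lookup (H k) (a k) *
          (x $ k + (\<Sum>j\<in>UNIV. of_nat (Poly_Mapping.lookup (a k) j) * x $ j))"
        by (simp add: sum.distrib flip: sum_distrib_left)
      also have "(\<Sum>j\<in>UNIV. of_nat (Poly_Mapping.lookup (a k) j) * x $ j) = ?r k * s"
        unfolding s_def sum_distrib_left
      proof (rule sum.cong)
        fix j
        have "of_nat (mdeg b * Poly_Mapping.lookup (a k) j) = (of_nat (mdeg (a k) * Poly_Mapping.lookup b j) :: 'a)"
          using parallel[OF aB weight_nonneg[OF aB a_nonneg]] by simp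
        with nb show "of_nat (Poly_Mapping.lookup (a k) j) * x $ j =
            ?r k * (of_nat (Poly_Mapping.lookup b j) * x $ j)"
          by (simp add: field_simps)
      qed simp
      finally show ?thesis using lk by (simp add: eq_neg_iff_add_eq_0)
    qed
    have "s = (\<Sum>j\<in>UNIV. of_nat (Poly_Mapping.lookup b j) * x $ j)" by (rule s_def)
    also have "\<dots> = - (\<Sum>j\<in>UNIV. of_nat (Poly_Mapping.lookup b j) * ?r j) * s"
      by (simp add: x sum_distrib_right mult.assoc sum_negf)
    finally have "s = - (\<Sum>j\<in>UNIV. of_nat (Poly_Mapping.lookup b j) * ?r j) * s" .
    \<comment> \<open>The factor in front of \<open>s\<close> is a natural number at least deg(b) >
      0, hence nonzero in characteristic zero.\<close>
    then have "(of_nat (mdeg b) + of_nat (\<Sum>j\<in>UNIV. Poly_Mapping.lookup b j * mdeg (a j))) * s = 0"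
      using nb by (simp add: field_simps flip: sum_divide_distrib)
    then have "s = 0" using b by (simp flip: of_nat_add del: of_nat_sum)
    with x show "x = 0" by (simp add: vec_eq_iff)
  qed
  ultimately show False by contradiction
qed

section \<open>Affine change of coordinates, reducing to L_i = x_i\<close>

lemma pdiff_tdeg_le_1:
  fixes p :: "('n::finite, 'a::comm_ring_1) mpoly"
  assumes "tdeg p \<le> 1"
  shows "pdiff j p = mconst (at0 (pdiff j p))"
proof -
  have "pdiff j p = (\<Sum>k\<in>UNIV. mconst (at0 (pdiff k p)) * (if j = k then 1 else 0))"
    by (subst tdeg_le_1_expand[OF assms]) (simp add: pdiff_add pdiff_sum pdiff_mult pdiff_mvar)
  also have "\<dots> = (\<Sum>k\<in>UNIV. if k = j then mconst (at0 (pdiff k p)) else 0)"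
    by (intro sum.cong) auto
  finally show ?thesis by simp
qed

lemma keller_invertible_imp_mconst:
  fixes L H :: "'n::finite \<Rightarrow> ('n, 'a::field_char_0) mpoly"
  assumes "keller (\<lambda>i. L i * H i)" and "\<And>i. tdeg (L i) \<le> 1" and "det (const_jacobian L) \<noteq> 0"
  shows "H i = mconst (at0 (H i))"
proof -
  define C where "C = const_jacobian L"
  define l where "l = (\<lambda>i. at0 (L i))"
  obtain A where "C ** A = mat 1" "A ** C = mat 1"
    using assms(3) unfolding C_def by (meson invertible_det_nz invertible_def)
  then have CA: "(\<Sum>j\<in>UNIV. C $ i $ j * A $ j $ k) = (if i = k then 1 else 0)"
    and AC: "(\<Sum>j\<in>UNIV. A $ i $ j * C $ j $ k) = (if i = k then 1 else 0)" for i k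
    by (simp_all add: matrix_matrix_mult_def mat_def vec_eq_iff)
  have expand: "L i = mconst (l i) + (\<Sum>j\<in>UNIV. mconst (C $ i $ j) * mvar j)" for i
    using tdeg_le_1_expand[OF assms(2)[of i]] by (simp add: C_def l_def const_jacobian_def)
  \<comment> \<open>The inverse of the affine map L: with L = Cx + l and \<open>A\<close> inverse to
    \<open>C\<close>, this is A(x - l).\<close>
  define f where "f = (\<lambda>j. \<Sum>k\<in>UNIV. mconst (A $ j $ k) * (mvar k - mconst (l k)))"
  have comp: "(\<Sum>j\<in>UNIV. mconst (X $ i $ j) * (\<Sum>k\<in>UNIV. mconst (Y $ j $ k) * g k)) = g i"
    if "\<And>k. (\<Sum>j\<in>UNIV. X $ i $ j * Y $ j $ k) = (if i = k then 1 else 0)"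
    for X Y :: "'a^'n^'n" and i and g :: "'n \<Rightarrow> ('n, 'a) mpoly"
  proof -
    have "(\<Sum>j\<in>UNIV. mconst (X $ i $ j) * (\<Sum>k\<in>UNIV. mconst (Y $ j $ k) * g k))
        = (\<Sum>k\<in>UNIV. mconst (\<Sum>j\<in>UNIV. X $ i $ j * Y $ j $ k) * g k)"
      unfolding sum_distrib_left mconst_sum sum_distrib_right
      by (subst sum.swap) (simp add: mconst_mult mult.assoc)
    also have "\<dots> = (\<Sum>k\<in>UNIV. if k = i then g k else 0)"
      unfolding that by (intro sum.cong) auto
    finally show ?thesis by simp
  qed
  have "psubst f (L i) = mvar i" for i
    by (subst expand) (simp add: psubst_add psubst_sum psubst_mult f_def comp CA)
  then have fF: "psubst f (L i * H i) = mvar i * psubst f (H i)" for i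
    by (simp add: psubst_mult)
  have "psubst L (mvar k - mconst (l k)) = L k - mconst (l k)" for k
    using psubst_add[of L "mvar k - mconst (l k)" "mconst (l k)"] by (simp add: algebra_simps)
  also have "\<dots> k = (\<Sum>j\<in>UNIV. mconst (C $ k $ j) * mvar j)" for k
    by (subst expand) simp
  finally have Lf: "psubst L (f j) = mvar j" for j
    by (simp add: f_def psubst_sum psubst_mult comp AC)
  have "pdiff k (mvar k' - mconst (l k')) = (if k = k' then 1 else 0)" for k k'
    using pdiff_add[of k "mvar k' - mconst (l k')" "mconst (l k')"] by (simp add: pdiff_mvar)
  then have "pdiff k (f j) = (\<Sum>k'\<in>UNIV. if k' = k then mconst (A $ j $ k') else 0)" for k j
    unfolding f_def pdiff_sum pdiff_mult by (intro sum.cong) auto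
  then have df: "pdiff k (f j) = mconst (A $ j $ k)" for k j by simp
  obtain c where c: "c \<noteq> 0" "det (jacobian (\<lambda>i. L i * H i)) = mconst c"
    using assms(1) by (auto simp: keller_def)
  \<comment> \<open>By the chain rule the new Jacobian is JF after substitution of \<open>f\<close>,
    times \<open>A\<close>. The constant determinant \<open>c\<close> is unchanged by the
    substitution, so the new map is again Keller.\<close>
  have "jacobian (\<lambda>i. mvar i * psubst f (H i)) =
      (\<chi> i j. psubst f (jacobian (\<lambda>i. L i * H i) $ i $ j)) ** (\<chi> i j. mconst (A $ i $ j))"
    by (simp add: vec_eq_iff jacobian_def matrix_matrix_mult_def pdiff_psubst df flip: fF)
  then have "det (jacobian (\<lambda>i. mvar i * psubst f (H i))) = mconst (c * det A)"
    by (simp add: det_mul c mconst_mult flip: det_psubst det_mconst)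
  moreover have "det A \<noteq> 0"
    using det_mul[of C A] \<open>C ** A = mat 1\<close> by auto
  ultimately have "keller (\<lambda>i. mvar i * psubst f (H i))"
    using c by (auto simp: keller_def intro!: exI[of _ "c * det A"])
  from keller_mvar_mult_imp_mconst[OF this, of i]
  obtain h where h: "psubst f (H i) = mconst h" by blast
  \<comment> \<open>Substituting L undoes the change of coordinates and fixes constants.\<close>
  have "H i = psubst L (psubst f (H i))"
    by (simp add: psubst_psubst Lf psubst_mvar_id)
  with h have "H i = mconst h" by simp
  then show ?thesis by simp
qed

text \<open>Row multilinearity. The matrix \<open>J\<close> is arbitrary so that it can be JF itself
  or JF after a point other than 0 has been substituted.\<close>

lemma at0_det_jacobian_mult:
  assumes "\<And>i j. at0 (J $ i $ j) = r i * at0 (pdiff j (L i))"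
  shows "at0 (det J) = (\<Prod>i\<in>UNIV. r i) * det (const_jacobian L)"
proof -
  have "at0 (det J) = det (\<chi> i. r i *s const_jacobian L $ i)"
    unfolding det_at0 by (simp add: assms const_jacobian_def vector_scalar_mult_def)
  then show ?thesis by (simp add: det_rows_mul)
qed

theorem theorem2p3:
  fixes F L H :: "'n::finite \<Rightarrow> ('n, 'a::field_char_0) mpoly"
  assumes "keller F"
    and "\<And>i. F i = L i * H i"
    and "\<And>i. tdeg (L i) = 1"
  shows "((\<forall>i. (L i - mconst (at0 (L i))) dvd hom_part 1 (mconst (at0 (L i)) * H i))
          \<longleftrightarrow> (\<chi> i. at0 (L i)) \<in> range (\<lambda>v. const_jacobian L *v v))
       \<and> ((\<chi> i. at0 (L i)) \<in> range (\<lambda>v. const_jacobian L *v v)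
          \<longleftrightarrow> det (const_jacobian L) \<noteq> 0)
       \<and> (det (const_jacobian L) \<noteq> 0 \<longleftrightarrow> map_deg F = 1)
       \<and> (map_deg F = 1 \<longleftrightarrow> (\<forall>i. irreducible (F i)))"
    (is "(?P1 \<longleftrightarrow> ?P2) \<and> (_ \<longleftrightarrow> ?P3) \<and> (_ \<longleftrightarrow> ?P4) \<and> (_ \<longleftrightarrow> ?P5)")
proof -
  obtain c where c: "c \<noteq> 0" "det (jacobian F) = mconst c"
    using assms(1) by (auto simp: keller_def)
  have L0: "L i \<noteq> 0" for i using assms(3)[of i] by (auto simp: tdeg_def)
  \<comment> \<open>Additivity of degrees needs nonzero factors, since \<open>tdeg 0\<close> is 0. A
    vanishing F_i would give JF a zero row.\<close>
  have F0: "F i \<noteq> 0" for i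
  proof
    assume "F i = 0"
    then have "row i (\<chi> i j. at0 (jacobian F $ i $ j)) = 0"
      by (simp add: row_def jacobian_def vec_eq_iff flip: mconst_simps(1))
    then have "at0 (det (jacobian F)) = 0"
      unfolding det_at0 by (rule det_zero_row)
    with c show False by simp
  qed
  then have H0: "H i \<noteq> 0" for i using assms(2)[of i] by auto
  have tdegF: "tdeg (F i) = Suc (tdeg (H i))" for i
    using tdeg_mult[OF L0 H0] assms(2,3) by simp
  have map_deg: "?P4 \<longleftrightarrow> (\<forall>i. tdeg (H i) = 0)"
  proof
    assume ?P4
    then have "tdeg (F i) \<le> 1" for i
      unfolding map_deg_def by (metis Max_ge finite finite_imageI rangeI)
    then show "\<forall>i. tdeg (H i) = 0" by (simp add: tdegF)
  next
    assume "\<forall>i. tdeg (H i) = 0"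
    then show ?P4 by (simp add: map_deg_def tdegF)
  qed
  have 31: ?P3 if dvd: ?P1
  proof -
    have "\<exists>r. \<forall>j. at0 (pdiff j (F i)) = r * at0 (pdiff j (L i))" for i
    proof -
      let ?p = "mconst (at0 (L i)) * H i"
      obtain q where q: "hom_part 1 ?p = (L i - mconst (at0 (L i))) * q"
        using dvd by (meson dvdE)
      have hom: "at0 (pdiff j (hom_part 1 ?p)) = at0 (pdiff j ?p)" for j
        unfolding at0_pdiff hom_part_def lookup_sum
        by (subst sum.cong[OF refl, where h = "\<lambda>m. if m = Poly_Mapping.single j 1 then Poly_Mapping.lookup ?p m else 0"])
          (auto simp: lookup_single when_def sum.delta in_keys_iff)
      have diff: "pdiff j (L i - mconst (at0 (L i))) = pdiff j (L i)" for j
        using pdiff_add[of j "L i - mconst (at0 (L i))" "mconst (at0 (L i))"] by simp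
      \<comment> \<open>In the product rule the summand with the factor L_i - L_i(0) vanishes at
        0.\<close>
      have "at0 (L i) * at0 (pdiff j (H i)) = at0 q * at0 (pdiff j (L i))" for j
        using hom[of j] unfolding q by (simp add: pdiff_mult at0_add at0_mult at0_diff diff mult.commute)
      then have "at0 (pdiff j (F i)) = (at0 q + at0 (H i)) * at0 (pdiff j (L i))" for j
        by (simp add: assms(2) pdiff_mult at0_add at0_mult algebra_simps)
      then show ?thesis by blast
    qed
    then obtain r where r: "\<And>i j. at0 (pdiff j (F i)) = r i * at0 (pdiff j (L i))" by metis
    have "at0 (det (jacobian F)) = (\<Prod>i\<in>UNIV. r i) * det (const_jacobian L)"
      by (rule at0_det_jacobian_mult) (simp add: jacobian_def r)
    with c show ?P3 by auto
  qed
  have 23: ?P3 if ?P2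
  proof -
    from that obtain v where v: "(\<chi> i. at0 (L i)) = const_jacobian L *v v" by blast
    \<comment> \<open>If L(0) = JL v, then L(-v) = 0. The map \<open>e\<close> evaluates at -v,
      where the gradient of L_i H_i is H_i(-v) times that of L_i.\<close>
    define e where "e = psubst (\<lambda>j. mconst (- v $ j) :: ('n, 'a) mpoly)"
    have e_hom: "e (p + q) = e p + e q" "e (p * q) = e p * e q"
      "e (det M) = det (\<chi> i j. e (M $ i $ j))" for p q and M :: "('n, 'a) mpoly^'n^'n"
      by (simp_all add: e_def psubst_add psubst_mult det_psubst)
    have "at0 (e (L i)) = at0 (L i) - (const_jacobian L *v v) $ i" for i
      by (subst tdeg_le_1_expand[of "L i"])
        (simp_all add: assms(3) e_def psubst_add psubst_sum psubst_mult at0_add at0_sum at0_mult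
          matrix_vector_mult_def const_jacobian_def sum_negf)
    then have eL: "at0 (e (L i)) = 0" for i by (simp flip: v)
    have dL: "at0 (e (pdiff j (L i))) = at0 (pdiff j (L i))" for i j
    proof -
      have "pdiff j (L i) = mconst (at0 (pdiff j (L i)))"
        by (rule pdiff_tdeg_le_1) (simp add: assms(3))
      then show ?thesis by (metis e_def psubst_mconst)
    qed
    have "at0 (e (det (jacobian F))) = (\<Prod>i\<in>UNIV. at0 (e (H i))) * det (const_jacobian L)"
      unfolding e_hom(3)
      by (rule at0_det_jacobian_mult)
        (simp add: jacobian_def assms(2) pdiff_mult e_hom at0_add at0_mult eL dL mult.commute)
    with c show ?P3 by (auto simp: e_def)
  qed
  have 34: ?P4 if ?P3
  proof -
    have "F = (\<lambda>i. L i * H i)" using assms(2) by auto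
    with assms(1) have "keller (\<lambda>i. L i * H i)" by simp
    then have "H i = mconst (at0 (H i))" for i
      using assms(3) that by (intro keller_invertible_imp_mconst) auto
    then have "tdeg (H i) = 0" for i by (metis tdeg_mconst)
    with map_deg show ?P4 by blast
  qed
  have const: "H i = mconst (at0 (H i))" if ?P4 for i
    using that map_deg tdeg_0_imp_mconst by blast
  have 43: ?P3 if ?P4
  proof -
    have "pdiff j (H i) = 0" for i j using const[OF that] by (metis pdiff_mconst)
    then have "at0 (det (jacobian F)) = (\<Prod>i\<in>UNIV. at0 (H i)) * det (const_jacobian L)"
      by (intro at0_det_jacobian_mult) (simp add: jacobian_def assms(2) pdiff_mult at0_mult)
    with c show ?P3 by auto
  qed
  have 41: ?P1 if ?P4
  proof
    fix i
    have "mconst (at0 (L i)) * H i = mconst (at0 (L i) * at0 (H i))"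
      using const[OF that, of i] by (metis mconst_mult)
    \<comment> \<open>A constant has zero linear part, and 0 is divisible by everything.\<close>
    then have "hom_part 1 (mconst (at0 (L i)) * H i) = 0"
      by (auto simp: hom_part_def mconst_def split: if_splits intro!: sum.neutral)
    then show "(L i - mconst (at0 (L i))) dvd hom_part 1 (mconst (at0 (L i)) * H i)" by simp
  qed
  have 32: ?P2 if ?P3
  proof -
    from that obtain A where "const_jacobian L ** A = mat 1"
      by (meson invertible_det_nz invertible_def)
    then have "const_jacobian L *v (A *v x) = x" for x
      by (simp add: matrix_vector_mul_assoc)
    then show ?P2 by (metis rangeI)
  qed
  have 45: ?P5 if ?P4
    using that map_deg by (auto simp: tdegF intro!: tdeg_1_imp_irreducible)
  have 54: ?P4 if ?P5
  proof -
    have "tdeg (H i) = 0" for i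
    proof -
      \<comment> \<open>L_i has degree 1 and is no unit, so H_i must be one.\<close>
      have "L i dvd 1 \<or> H i dvd 1"
        using that assms(2)[of i] by (metis irreducibleD)
      then show ?thesis by (auto simp: mpoly_dvd_1_iff assms(3))
    qed
    with map_deg show ?P4 by blast
  qed
  show ?thesis using 31 23 34 43 41 32 45 54 by blast
qed

end
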